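(* Let $\mathcal{D}$ be a triangulated category and let $D_1=(D_1^{\leqslant 0},D_1^{\geqslant 1})$ and $D_2=(D_2^{\leqslant 0},D_2^{\geqslant 1})$ be t-structures on $\mathcal{D}$ with $D_1^{\leqslant 0}\subseteq D_2^{\leqslant 0}$. Put $\mathcal{H}=D_1^{\geqslant 1}\cap D_2^{\leqslant 0}$. Then there is a one-to-one correspondence between (i) the t-structures $D_i=(D_i^{\leqslant 0},D_i^{\geqslant 1})$ on $\mathcal{D}$ such that $D_1^{\leqslant 0}\subseteq D_i^{\leqslant 0}\subseteq D_2^{\leqslant 0}$, and (ii) the t-structures $(U^{\leqslant 0},U^{\geqslant 1})$ on $\mathcal{H}$, given by the well-defined, mutually inverse assignments $$(D_i^{\leqslant 0},D_i^{\geqslant 1})\mapsto(\mathcal{H}\cap D_i^{\leqslant 0},\ D_i^{\geqslant 1}\cap\mathcal{H}),\qquad (U^{\leqslant 0},U^{\geqslant 1})\mapsto(D_1^{\leqslant 0}\ast U^{\leqslant 0},\ U^{\geqslant 1}\ast D_2^{\geqslant 1}).$$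
   Context: $\Sigma$ is the translation functor of $\mathcal{D}$. All full subcategories are taken closed under isomorphism. For full subcategories $\mathcal{X},\mathcal{Y}$ of $\mathcal{D}$, $\mathcal{X}\ast\mathcal{Y}$ is the full subcategory of objects $Z$ for which there is a distinguished triangle $X\to Z\to Y\to\Sigma(X)$ with $X\in\mathcal{X}$, $Y\in\mathcal{Y}$. A t-structure $D_1=(D_1^{\leqslant 0},D_1^{\geqslant 1})$ on $\mathcal{D}$ is a pair of full subcategories with: (T1) $\Sigma D_1^{\leqslant 0}\subseteq D_1^{\leqslant 0}$ and $D_1^{\geqslant 1}\subseteq\Sigma D_1^{\geqslant 1}$; (T2) $\mathrm{Hom}_{\mathcal{D}}(D_1^{\leqslant 0},D_1^{\geqslant 1})=0$; (T3) every $X\in\mathcal{D}$ fits in a distinguished triangle $X_0\to X\to X_1\to\Sigma(X_0)$ with $X_0\in D_1^{\leqslant 0}$, $X_1\in D_1^{\geqslant 1}$. For an integer $n$, $D_1^{\leqslant n}=\Sigma^{-n}D_1^{\leqslant 0}$ and $D_1^{\geqslant n}=\Sigma^{-n+1}D_1^{\geqslant 1}$. A t-structure on $\mathcal{H}=D_1^{\geqslant 1}\cap D_2^{\leqslant 0}$ (where $D_1^{\leqslant 0}\subseteq D_2^{\leqslant 0}$) is a pair $(U^{\leqslant 0},U^{\geqslant 1})$ of full subcategories of $\mathcal{H}$ such that, writing $U^{\leqslant n}=\Sigma^{-n}(U^{\leqslant 0})$ and $U^{\geqslant n}=\Sigma^{-n+1}(U^{\geqslant 1})$ (as subcategories of $\mathcal{D}$):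 (T1') $D_1^{\leqslant 0}\ast U^{\leqslant 0}\subseteq D_1^{\leqslant 1}\ast U^{\leqslant 1}$ and $U^{\geqslant 1}\ast D_2^{\geqslant 1}\subseteq U^{\geqslant 0}\ast D_2^{\geqslant 0}$; (T2') $\mathrm{Hom}_{\mathcal{D}}(U^{\leqslant 0},U^{\geqslant 1})=0$; (T3') for every $X\in\mathcal{H}$ there is a distinguished triangle $Y\to X\to Z\to\Sigma(Y)$ with $Y\in U^{\leqslant 0}$ and $Z\in U^{\geqslant 1}$. *)

theory Defs
  imports "HOL-Algebra.Group"
begin

text \<open>
  Morphisms have disjoint hom-sets, so composition and addition need no object arguments.
  Composition is in the order of functions: \<open>g \<cdot> f\<close> is \<open>g\<close> after \<open>f\<close>.
  All fields are only meaningful on \<open>Obj\<close> and on the hom-sets.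
\<close>

record ('o, 'm) category_data =
  Obj :: "'o set"
  Hom :: "'o \<Rightarrow> 'o \<Rightarrow> 'm set"
  cmp :: "'m \<Rightarrow> 'm \<Rightarrow> 'm"  (infixl "\<cdot>\<index>" 70)
  idt :: "'o \<Rightarrow> 'm"

locale category =
  fixes \<D> :: "('o, 'm, 'z) category_data_scheme" (structure)
  assumes Hom_disjoint:
      "\<lbrakk>X \<in> Obj \<D>; Y \<in> Obj \<D>; X' \<in> Obj \<D>; Y' \<in> Obj \<D>;
        f \<in> Hom \<D> X Y; f \<in> Hom \<D> X' Y'\<rbrakk> \<Longrightarrow> X = X' \<and> Y = Y'"
    and cmp_closed:
      "\<lbrakk>X \<in> Obj \<D>; Y \<in> Obj \<D>; Z \<in> Obj \<D>; f \<in> Hom \<D> X Y; g \<in> Hom \<D> Y Z\<rbrakk>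
        \<Longrightarrow> g \<cdot> f \<in> Hom \<D> X Z"
    and cmp_assoc:
      "\<lbrakk>W \<in> Obj \<D>; X \<in> Obj \<D>; Y \<in> Obj \<D>; Z \<in> Obj \<D>;
        f \<in> Hom \<D> W X; g \<in> Hom \<D> X Y; h \<in> Hom \<D> Y Z\<rbrakk>
        \<Longrightarrow> h \<cdot> (g \<cdot> f) = (h \<cdot> g) \<cdot> f"
    and idt_closed: "X \<in> Obj \<D> \<Longrightarrow> idt \<D> X \<in> Hom \<D> X X"
    and idt_right: "\<lbrakk>X \<in> Obj \<D>; Y \<in> Obj \<D>; f \<in> Hom \<D> X Y\<rbrakk> \<Longrightarrow> f \<cdot> idt \<D> X = f"
    and idt_left: "\<lbrakk>X \<in> Obj \<D>; Y \<in> Obj \<D>; f \<in> Hom \<D> X Y\<rbrakk> \<Longrightarrow> idt \<D> Y \<cdot> f = f"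

definition iso_hom ::
    "('o, 'm, 'z) category_data_scheme \<Rightarrow> 'o \<Rightarrow> 'o \<Rightarrow> 'm \<Rightarrow> bool" where
  "iso_hom \<D> X Y f \<longleftrightarrow>
     f \<in> Hom \<D> X Y \<and>
     (\<exists>g \<in> Hom \<D> Y X. g \<cdot>\<^bsub>\<D>\<^esub> f = idt \<D> X \<and> f \<cdot>\<^bsub>\<D>\<^esub> g = idt \<D> Y)"

definition iso_obj :: "('o, 'm, 'z) category_data_scheme \<Rightarrow> 'o \<Rightarrow> 'o \<Rightarrow> bool" where
  "iso_obj \<D> X Y \<longleftrightarrow> X \<in> Obj \<D> \<and> Y \<in> Obj \<D> \<and> (\<exists>f. iso_hom \<D> X Y f)"

text \<open>A full subcategory closed under isomorphism is represented by its set of objects.\<close>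

definition replete_subcat :: "('o, 'm, 'z) category_data_scheme \<Rightarrow> 'o set \<Rightarrow> bool" where
  "replete_subcat \<D> \<X> \<longleftrightarrow>
     \<X> \<subseteq> Obj \<D> \<and> (\<forall>X \<in> \<X>. \<forall>Y. iso_obj \<D> X Y \<longrightarrow> Y \<in> \<X>)"

record ('o, 'm) additive_data = "('o, 'm) category_data" +
  addm :: "'m \<Rightarrow> 'm \<Rightarrow> 'm"  (infixl "\<boxplus>\<index>" 65)
  zerom :: "'o \<Rightarrow> 'o \<Rightarrow> 'm"

text \<open>The abelian group of morphisms, in the multiplicative record format of the library.\<close>

definition hom_group ::
    "('o, 'm, 'z) additive_data_scheme \<Rightarrow> 'o \<Rightarrow> 'o \<Rightarrow> 'm monoid" where
  "hom_group \<D> X Y =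
     \<lparr>carrier = Hom \<D> X Y, monoid.mult = addm \<D>, one = zerom \<D> X Y\<rparr>"

definition zero_object :: "('o, 'm, 'z) additive_data_scheme \<Rightarrow> 'o \<Rightarrow> bool" where
  "zero_object \<D> N \<longleftrightarrow>
     N \<in> Obj \<D> \<and>
     (\<forall>X \<in> Obj \<D>. Hom \<D> X N = {zerom \<D> X N} \<and> Hom \<D> N X = {zerom \<D> N X})"

locale additive_category = category \<D>
  for \<D> :: "('o, 'm, 'z) additive_data_scheme" (structure) +
  assumes hom_comm_group:
      "\<lbrakk>X \<in> Obj \<D>; Y \<in> Obj \<D>\<rbrakk> \<Longrightarrow> comm_group (hom_group \<D> X Y)"
    and cmp_add_right:
      "\<lbrakk>X \<in> Obj \<D>; Y \<in> Obj \<D>; Z \<in> Obj \<D>;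
        f \<in> Hom \<D> X Y; f' \<in> Hom \<D> X Y; g \<in> Hom \<D> Y Z\<rbrakk>
        \<Longrightarrow> g \<cdot> (f \<boxplus> f') = (g \<cdot> f) \<boxplus> (g \<cdot> f')"
    and cmp_add_left:
      "\<lbrakk>X \<in> Obj \<D>; Y \<in> Obj \<D>; Z \<in> Obj \<D>;
        f \<in> Hom \<D> X Y; g \<in> Hom \<D> Y Z; g' \<in> Hom \<D> Y Z\<rbrakk>
        \<Longrightarrow> (g \<boxplus> g') \<cdot> f = (g \<cdot> f) \<boxplus> (g' \<cdot> f)"
    and ex_zero_object: "\<exists>N. zero_object \<D> N"
    and ex_biproduct:
      "\<lbrakk>X \<in> Obj \<D>; Y \<in> Obj \<D>\<rbrakk> \<Longrightarrow>
        \<exists>P \<in> Obj \<D>. \<exists>i \<in> Hom \<D> X P. \<exists>j \<in> Hom \<D> Y P. \<exists>p \<in> Hom \<D> P X. \<exists>q \<in> Hom \<D> P Y.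
          p \<cdot> i = idt \<D> X \<and> q \<cdot> j = idt \<D> Y \<and>
          q \<cdot> i = zerom \<D> X Y \<and> p \<cdot> j = zerom \<D> Y X \<and>
          (i \<cdot> p) \<boxplus> (j \<cdot> q) = idt \<D> P"

record ('o, 'm) triangulated_data = "('o, 'm) additive_data" +
  \<Sigma>o :: "'o \<Rightarrow> 'o"
  \<Sigma>m :: "'m \<Rightarrow> 'm"
  Tri :: "('m \<times> 'm \<times> 'm) set"

definition dist_triangle ::
    "('o, 'm, 'z) triangulated_data_scheme \<Rightarrow> 'o \<Rightarrow> 'o \<Rightarrow> 'o \<Rightarrow> 'm \<Rightarrow> 'm \<Rightarrow> 'm \<Rightarrow> bool" where
  "dist_triangle \<D> X Y Z f g h \<longleftrightarrow>
     X \<in> Obj \<D> \<and> Y \<in> Obj \<D> \<and> Z \<in> Obj \<D> \<and>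
     f \<in> Hom \<D> X Y \<and> g \<in> Hom \<D> Y Z \<and> h \<in> Hom \<D> Z (\<Sigma>o \<D> X) \<and>
     (f, g, h) \<in> Tri \<D>"

text \<open>
  The translation functor is an additive auto-equivalence; it is not required to be
  invertible on the nose. The axioms are Verdier's (TR1)--(TR4).
\<close>

locale triangulated_category = additive_category \<D>
  for \<D> :: "('o, 'm, 'z) triangulated_data_scheme" (structure) +
  assumes shift_obj: "X \<in> Obj \<D> \<Longrightarrow> \<Sigma>o \<D> X \<in> Obj \<D>"
    and shift_idt: "X \<in> Obj \<D> \<Longrightarrow> \<Sigma>m \<D> (idt \<D> X) = idt \<D> (\<Sigma>o \<D> X)"
    and shift_cmp:
      "\<lbrakk>X \<in> Obj \<D>; Y \<in> Obj \<D>; Z \<in> Obj \<D>; f \<in> Hom \<D> X Y; g \<in> Hom \<D> Y Z\<rbrakk>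
        \<Longrightarrow> \<Sigma>m \<D> (g \<cdot> f) = \<Sigma>m \<D> g \<cdot> \<Sigma>m \<D> f"
    and shift_add:
      "\<lbrakk>X \<in> Obj \<D>; Y \<in> Obj \<D>; f \<in> Hom \<D> X Y; f' \<in> Hom \<D> X Y\<rbrakk>
        \<Longrightarrow> \<Sigma>m \<D> (f \<boxplus> f') = \<Sigma>m \<D> f \<boxplus> \<Sigma>m \<D> f'"
    and shift_fully_faithful:
      "\<lbrakk>X \<in> Obj \<D>; Y \<in> Obj \<D>\<rbrakk>
        \<Longrightarrow> bij_betw (\<Sigma>m \<D>) (Hom \<D> X Y) (Hom \<D> (\<Sigma>o \<D> X) (\<Sigma>o \<D> Y))"
    and shift_ess_surj: "Y \<in> Obj \<D> \<Longrightarrow> \<exists>X \<in> Obj \<D>. iso_obj \<D> (\<Sigma>o \<D> X) Y"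
    and TR1_iso:
      "\<lbrakk>dist_triangle \<D> X Y Z f g h;
        X' \<in> Obj \<D>; Y' \<in> Obj \<D>; Z' \<in> Obj \<D>;
        f' \<in> Hom \<D> X' Y'; g' \<in> Hom \<D> Y' Z'; h' \<in> Hom \<D> Z' (\<Sigma>o \<D> X');
        iso_hom \<D> X X' a; iso_hom \<D> Y Y' b; iso_hom \<D> Z Z' c;
        f' \<cdot> a = b \<cdot> f; g' \<cdot> b = c \<cdot> g; h' \<cdot> c = \<Sigma>m \<D> a \<cdot> h\<rbrakk>
        \<Longrightarrow> dist_triangle \<D> X' Y' Z' f' g' h'"
    and TR1_idt:
      "\<lbrakk>X \<in> Obj \<D>; zero_object \<D> N\<rbrakk>
        \<Longrightarrow> dist_triangle \<D> X X N (idt \<D> X) (zerom \<D> X N) (zerom \<D> N (\<Sigma>o \<D> X))"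
    and TR1_cone:
      "\<lbrakk>X \<in> Obj \<D>; Y \<in> Obj \<D>; f \<in> Hom \<D> X Y\<rbrakk>
        \<Longrightarrow> \<exists>Z g h. dist_triangle \<D> X Y Z f g h"
    and TR2:
      "\<lbrakk>X \<in> Obj \<D>; Y \<in> Obj \<D>; Z \<in> Obj \<D>;
        f \<in> Hom \<D> X Y; g \<in> Hom \<D> Y Z; h \<in> Hom \<D> Z (\<Sigma>o \<D> X)\<rbrakk>
        \<Longrightarrow> dist_triangle \<D> X Y Z f g h \<longleftrightarrow>
            dist_triangle \<D> Y Z (\<Sigma>o \<D> X) g h
              (inv\<^bsub>hom_group \<D> (\<Sigma>o \<D> X) (\<Sigma>o \<D> Y)\<^esub> (\<Sigma>m \<D> f))"
    and TR3:
      "\<lbrakk>dist_triangle \<D> X Y Z f g h; dist_triangle \<D> X' Y' Z' f' g' h';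
        a \<in> Hom \<D> X X'; b \<in> Hom \<D> Y Y'; f' \<cdot> a = b \<cdot> f\<rbrakk>
        \<Longrightarrow> \<exists>c \<in> Hom \<D> Z Z'. g' \<cdot> b = c \<cdot> g \<and> h' \<cdot> c = \<Sigma>m \<D> a \<cdot> h"
    and TR4:
      "\<lbrakk>dist_triangle \<D> X Y C\<^sub>u u a b;
        dist_triangle \<D> Y Z C\<^sub>v v c d;
        dist_triangle \<D> X Z C\<^sub>v\<^sub>u (v \<cdot> u) e k\<rbrakk>
        \<Longrightarrow> \<exists>p q. dist_triangle \<D> C\<^sub>u C\<^sub>v\<^sub>u C\<^sub>v p q (\<Sigma>m \<D> a \<cdot> d) \<and>
              p \<cdot> a = e \<cdot> v \<and> k \<cdot> p = b \<and>
              q \<cdot> e = c \<and> d \<cdot> q = \<Sigma>m \<D> u \<cdot> k"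

definition star ::
    "('o, 'm, 'z) triangulated_data_scheme \<Rightarrow> 'o set \<Rightarrow> 'o set \<Rightarrow> 'o set"
    (infixl "\<star>\<index>" 70) where
  "\<X> \<star>\<^bsub>\<D>\<^esub> \<Y> = {Z. \<exists>X \<in> \<X>. \<exists>Y \<in> \<Y>. \<exists>f g h. dist_triangle \<D> X Z Y f g h}"

text \<open>
  The subcategory \<open>\<Sigma>\<^sup>n(\<X>)\<close> for an integer \<open>n\<close>, closed under isomorphism. One of the two
  exponents is zero: for \<open>n \<ge> 0\<close> the condition reads \<open>\<Sigma>\<^sup>n X \<cong> Y\<close>, and for \<open>n < 0\<close>
  it reads \<open>X \<cong> \<Sigma>\<^sup>-\<^sup>n Y\<close>, so that no choice of a quasi-inverse of \<open>\<Sigma>\<close> is needed.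
\<close>

definition shift_subcat ::
    "('o, 'm, 'z) triangulated_data_scheme \<Rightarrow> int \<Rightarrow> 'o set \<Rightarrow> 'o set" where
  "shift_subcat \<D> n \<X> =
     {Y \<in> Obj \<D>. \<exists>X \<in> \<X>.
        iso_obj \<D> ((\<Sigma>o \<D> ^^ nat n) X) ((\<Sigma>o \<D> ^^ nat (- n)) Y)}"

text \<open>
  For a pair \<open>(L, R)\<close> standing for \<open>(D\<^sup>\<le>\<^sup>0, D\<^sup>\<ge>\<^sup>1)\<close>, the following are
  \<open>D\<^sup>\<le>\<^sup>n\<close>, computed from \<open>L\<close>, and \<open>D\<^sup>\<ge>\<^sup>n\<close>, computed from \<open>R\<close>.
\<close>

definition sub_le :: "('o, 'm, 'z) triangulated_data_scheme \<Rightarrow> 'o set \<Rightarrow> int \<Rightarrow> 'o set" where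
  "sub_le \<D> L n = shift_subcat \<D> (- n) L"

definition sub_ge :: "('o, 'm, 'z) triangulated_data_scheme \<Rightarrow> 'o set \<Rightarrow> int \<Rightarrow> 'o set" where
  "sub_ge \<D> R n = shift_subcat \<D> (- n + 1) R"

definition hom_orthogonal ::
    "('o, 'm, 'z) additive_data_scheme \<Rightarrow> 'o set \<Rightarrow> 'o set \<Rightarrow> bool" where
  "hom_orthogonal \<D> \<X> \<Y> \<longleftrightarrow> (\<forall>X \<in> \<X>. \<forall>Y \<in> \<Y>. Hom \<D> X Y = {zerom \<D> X Y})"

definition t_structure ::
    "('o, 'm, 'z) triangulated_data_scheme \<Rightarrow> 'o set \<times> 'o set \<Rightarrow> bool" where
  "t_structure \<D> = (\<lambda>(L, R).
     replete_subcat \<D> L \<and> replete_subcat \<D> R \<and>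
     shift_subcat \<D> 1 L \<subseteq> L \<and> R \<subseteq> shift_subcat \<D> 1 R \<and>
     hom_orthogonal \<D> L R \<and>
     (\<forall>X \<in> Obj \<D>. \<exists>X\<^sub>0 \<in> L. \<exists>X\<^sub>1 \<in> R. \<exists>f g h. dist_triangle \<D> X\<^sub>0 X X\<^sub>1 f g h))"

definition heart :: "'o set \<times> 'o set \<Rightarrow> 'o set \<times> 'o set \<Rightarrow> 'o set" where
  "heart D\<^sub>1 D\<^sub>2 = snd D\<^sub>1 \<inter> fst D\<^sub>2"

definition t_structure_on_heart ::
    "('o, 'm, 'z) triangulated_data_scheme \<Rightarrow> 'o set \<times> 'o set \<Rightarrow> 'o set \<times> 'o set \<Rightarrow>
      'o set \<times> 'o set \<Rightarrow> bool" where
  "t_structure_on_heart \<D> D\<^sub>1 D\<^sub>2 = (\<lambda>(U, V).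
     U \<subseteq> heart D\<^sub>1 D\<^sub>2 \<and> V \<subseteq> heart D\<^sub>1 D\<^sub>2 \<and>
     replete_subcat \<D> U \<and> replete_subcat \<D> V \<and>
     fst D\<^sub>1 \<star>\<^bsub>\<D>\<^esub> U \<subseteq> sub_le \<D> (fst D\<^sub>1) 1 \<star>\<^bsub>\<D>\<^esub> sub_le \<D> U 1 \<and>
     V \<star>\<^bsub>\<D>\<^esub> snd D\<^sub>2 \<subseteq> sub_ge \<D> V 0 \<star>\<^bsub>\<D>\<^esub> sub_ge \<D> (snd D\<^sub>2) 0 \<and>
     hom_orthogonal \<D> U V \<and>
     (\<forall>X \<in> heart D\<^sub>1 D\<^sub>2. \<exists>Y \<in> U. \<exists>Z \<in> V. \<exists>f g h. dist_triangle \<D> Y X Z f g h))"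

definition intermediate_t_structures ::
    "('o, 'm, 'z) triangulated_data_scheme \<Rightarrow> 'o set \<times> 'o set \<Rightarrow> 'o set \<times> 'o set \<Rightarrow>
      ('o set \<times> 'o set) set" where
  "intermediate_t_structures \<D> D\<^sub>1 D\<^sub>2 =
     {T. t_structure \<D> T \<and> fst D\<^sub>1 \<subseteq> fst T \<and> fst T \<subseteq> fst D\<^sub>2}"

definition heart_t_structures ::
    "('o, 'm, 'z) triangulated_data_scheme \<Rightarrow> 'o set \<times> 'o set \<Rightarrow> 'o set \<times> 'o set \<Rightarrow>
      ('o set \<times> 'o set) set" where
  "heart_t_structures \<D> D\<^sub>1 D\<^sub>2 = {W. t_structure_on_heart \<D> D\<^sub>1 D\<^sub>2 W}"

definition restrict_to_heart ::
    "'o set \<times> 'o set \<Rightarrow> 'o set \<times> 'o set \<Rightarrow> 'o set \<times> 'o set \<Rightarrow> 'o set \<times> 'o set" where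
  "restrict_to_heart D\<^sub>1 D\<^sub>2 = (\<lambda>(L, R). (heart D\<^sub>1 D\<^sub>2 \<inter> L, R \<inter> heart D\<^sub>1 D\<^sub>2))"

definition extend_from_heart ::
    "('o, 'm, 'z) triangulated_data_scheme \<Rightarrow> 'o set \<times> 'o set \<Rightarrow> 'o set \<times> 'o set \<Rightarrow>
      'o set \<times> 'o set \<Rightarrow> 'o set \<times> 'o set" where
  "extend_from_heart \<D> D\<^sub>1 D\<^sub>2 = (\<lambda>(U, V). (fst D\<^sub>1 \<star>\<^bsub>\<D>\<^esub> U, V \<star>\<^bsub>\<D>\<^esub> snd D\<^sub>2))"

end

theory Submission imports Defs begin

text \<open>
  Each half of a t-structure is determined by the other through vanishing of morphisms, so the
  closure properties of the halves reduce to vanishing statements along triangles. For an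
  intermediate t-structure \<open>(L, R)\<close>, truncating with respect to \<open>D\<^sub>1\<close> and \<open>D\<^sub>2\<close> gives
  \<open>L = D\<^sub>1\<^sup>\<le>\<^sup>0 \<star> (\<H> \<inter> L)\<close> and \<open>R = (R \<inter> \<H>) \<star> D\<^sub>2\<^sup>\<ge>\<^sup>1\<close>. Conversely, every object lies in
  \<open>(D\<^sub>1\<^sup>\<le>\<^sup>0 \<star> \<H>) \<star> D\<^sub>2\<^sup>\<ge>\<^sup>1\<close>, and \<open>\<H> \<subseteq> U \<star> V\<close>; since \<open>\<star>\<close> is associative (the octahedral
  axiom), every object lies in \<open>(D\<^sub>1\<^sup>\<le>\<^sup>0 \<star> U) \<star> (V \<star> D\<^sub>2\<^sup>\<ge>\<^sup>1)\<close>.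
\<close>

section \<open>Isomorphisms and zero objects\<close>

context category
begin

lemma iso_hom_idt: "X \<in> Obj \<D> \<Longrightarrow> iso_hom \<D> X X (idt \<D> X)"
  unfolding iso_hom_def using idt_closed idt_left by blast

lemma iso_obj_refl: "X \<in> Obj \<D> \<Longrightarrow> iso_obj \<D> X X"
  unfolding iso_obj_def using iso_hom_idt by blast

lemma iso_obj_sym: "iso_obj \<D> X Y \<Longrightarrow> iso_obj \<D> Y X"
  unfolding iso_obj_def iso_hom_def by blast

end

context additive_category
begin

text \<open>The additive inverse of a morphism. The notation is multiplicative because
  \<open>hom_group\<close> uses the library's record format, and source and target are arguments
  because they select the group.\<close>

abbreviation neg where "neg X Y f \<equiv> inv\<^bsub>hom_group \<D> X Y\<^esub> f"

abbreviation vanish where "vanish X Y \<equiv> Hom \<D> X Y = {zerom \<D> X Y}"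

section \<open>Calculus of zero and negative morphisms\<close>

lemma zerom_closed:
  assumes "X \<in> Obj \<D>" "Y \<in> Obj \<D>"
  shows "zerom \<D> X Y \<in> Hom \<D> X Y"
proof -
  interpret comm_group "hom_group \<D> X Y" by (rule hom_comm_group[OF assms])
  show ?thesis using one_closed by (simp add: hom_group_def)
qed

lemma neg_closed:
  assumes "X \<in> Obj \<D>" "Y \<in> Obj \<D>" "f \<in> Hom \<D> X Y"
  shows "neg X Y f \<in> Hom \<D> X Y"
proof -
  interpret comm_group "hom_group \<D> X Y" by (rule hom_comm_group[OF assms(1,2)])
  show ?thesis using inv_closed assms(3) by (simp add: hom_group_def)
qed

lemma neg_neg:
  assumes "X \<in> Obj \<D>" "Y \<in> Obj \<D>" "f \<in> Hom \<D> X Y"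
  shows "neg X Y (neg X Y f) = f"
proof -
  interpret comm_group "hom_group \<D> X Y" by (rule hom_comm_group[OF assms(1,2)])
  show ?thesis using inv_inv[of f] assms(3) by (simp add: hom_group_def)
qed

lemma add_neg:
  assumes "X \<in> Obj \<D>" "Y \<in> Obj \<D>" "f \<in> Hom \<D> X Y"
  shows "neg X Y f \<boxplus> f = zerom \<D> X Y"
proof -
  interpret comm_group "hom_group \<D> X Y" by (rule hom_comm_group[OF assms(1,2)])
  show ?thesis using l_inv[of f] assms(3) by (simp add: hom_group_def)
qed

lemma zero_add:
  assumes "X \<in> Obj \<D>" "Y \<in> Obj \<D>"
  shows "zerom \<D> X Y \<boxplus> zerom \<D> X Y = zerom \<D> X Y"
proof -
  interpret comm_group "hom_group \<D> X Y" by (rule hom_comm_group[OF assms(1,2)])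
  show ?thesis using r_one[OF one_closed] by (simp add: hom_group_def)
qed

lemma neg_unique:
  assumes "X \<in> Obj \<D>" "Y \<in> Obj \<D>" "f \<in> Hom \<D> X Y" "g \<in> Hom \<D> X Y"
    "g \<boxplus> f = zerom \<D> X Y"
  shows "g = neg X Y f"
proof -
  interpret comm_group "hom_group \<D> X Y" by (rule hom_comm_group[OF assms(1,2)])
  show ?thesis using inv_equality[of g f] assms(3-5) by (simp add: hom_group_def)
qed

text \<open>Cancellation in the hom-group. It is the way to see that an additive operation preserves
  zero: the image of zero is its own double.\<close>

lemma zero_unique:
  assumes "X \<in> Obj \<D>" "Y \<in> Obj \<D>" "f \<in> Hom \<D> X Y" "f \<boxplus> f = f"
  shows "f = zerom \<D> X Y"
proof -
  interpret comm_group "hom_group \<D> X Y" by (rule hom_comm_group[OF assms(1,2)])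
  show ?thesis using r_cancel_one'[of f f] assms(3-4) by (simp add: hom_group_def)
qed

lemma cmp_zero_right:
  assumes "X \<in> Obj \<D>" "Y \<in> Obj \<D>" "Z \<in> Obj \<D>" "g \<in> Hom \<D> Y Z"
  shows "g \<cdot> zerom \<D> X Y = zerom \<D> X Z"
  by (rule zero_unique)
    (use assms cmp_add_right[of X Y Z "zerom \<D> X Y" "zerom \<D> X Y" g] in
      \<open>auto simp: zero_add zerom_closed intro: cmp_closed\<close>)

lemma cmp_zero_left:
  assumes "X \<in> Obj \<D>" "Y \<in> Obj \<D>" "Z \<in> Obj \<D>" "f \<in> Hom \<D> X Y"
  shows "zerom \<D> Y Z \<cdot> f = zerom \<D> X Z"
  by (rule zero_unique)
    (use assms cmp_add_left[of X Y Z f "zerom \<D> Y Z" "zerom \<D> Y Z"] in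
      \<open>auto simp: zero_add zerom_closed intro: cmp_closed\<close>)

lemma cmp_neg_right:
  assumes "X \<in> Obj \<D>" "Y \<in> Obj \<D>" "Z \<in> Obj \<D>" "f \<in> Hom \<D> X Y" "g \<in> Hom \<D> Y Z"
  shows "g \<cdot> neg X Y f = neg X Z (g \<cdot> f)"
  by (rule neg_unique)
    (use assms cmp_add_right[of X Y Z "neg X Y f" f g] in
      \<open>auto simp: add_neg cmp_zero_right neg_closed intro: cmp_closed\<close>)

lemma cmp_neg_left:
  assumes "X \<in> Obj \<D>" "Y \<in> Obj \<D>" "Z \<in> Obj \<D>" "f \<in> Hom \<D> X Y" "g \<in> Hom \<D> Y Z"
  shows "neg Y Z g \<cdot> f = neg X Z (g \<cdot> f)"
  by (rule neg_unique)
    (use assms cmp_add_left[of X Y Z f "neg Y Z g" g] in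
      \<open>auto simp: add_neg cmp_zero_left neg_closed intro: cmp_closed\<close>)

lemma vanishI:
  assumes "X \<in> Obj \<D>" "Y \<in> Obj \<D>" "\<And>f. f \<in> Hom \<D> X Y \<Longrightarrow> f = zerom \<D> X Y"
  shows "vanish X Y"
  using assms zerom_closed by blast

text \<open>The identity of \<open>X\<close> is then zero, so every morphism into or out of
  \<open>X\<close>, composed with it, is zero.\<close>

lemma zero_objectI:
  assumes "X \<in> Obj \<D>" "vanish X X"
  shows "zero_object \<D> X"
proof -
  have id0: "idt \<D> X = zerom \<D> X X" using idt_closed assms by auto
  have "vanish W X" if "W \<in> Obj \<D>" for W
    using vanishI that assms(1) id0 idt_left cmp_zero_left by metis
  moreover have "vanish X W" if "W \<in> Obj \<D>" for W
    using vanishI that assms(1) id0 idt_right cmp_zero_right by metis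
  ultimately show ?thesis using assms(1) by (auto simp: zero_object_def)
qed

end

section \<open>Triangles\<close>

context triangulated_category
begin

text \<open>Most arguments use only which three objects occur in a triangle. Forgetting the
  morphisms also removes the signs that rotation introduces.\<close>

abbreviation tri where "tri X Y Z \<equiv> \<exists>f g h. dist_triangle \<D> X Y Z f g h"

lemma triangleD:
  assumes "dist_triangle \<D> X Y Z f g h"
  shows "X \<in> Obj \<D>" "Y \<in> Obj \<D>" "Z \<in> Obj \<D>"
    "f \<in> Hom \<D> X Y" "g \<in> Hom \<D> Y Z" "h \<in> Hom \<D> Z (\<Sigma>o \<D> X)"
  using assms by (auto simp: dist_triangle_def)

section \<open>Translation of morphisms, and rotation of triangles\<close>

lemma shift_closed:
  assumes "X \<in> Obj \<D>" "Y \<in> Obj \<D>" "f \<in> Hom \<D> X Y"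
  shows "\<Sigma>m \<D> f \<in> Hom \<D> (\<Sigma>o \<D> X) (\<Sigma>o \<D> Y)"
  using shift_fully_faithful[OF assms(1,2)] assms(3) by (auto simp: bij_betw_def)

lemma shift_full:
  assumes "X \<in> Obj \<D>" "Y \<in> Obj \<D>" "g \<in> Hom \<D> (\<Sigma>o \<D> X) (\<Sigma>o \<D> Y)"
  obtains f where "f \<in> Hom \<D> X Y" "g = \<Sigma>m \<D> f"
  using shift_fully_faithful[OF assms(1,2)] assms(3) unfolding bij_betw_def by blast

lemma shift_inj:
  assumes "X \<in> Obj \<D>" "Y \<in> Obj \<D>" "f \<in> Hom \<D> X Y" "f' \<in> Hom \<D> X Y" "\<Sigma>m \<D> f = \<Sigma>m \<D> f'"
  shows "f = f'"
  using shift_fully_faithful[OF assms(1,2)] assms(3-5) unfolding bij_betw_def inj_on_def by blast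

lemma shift_zero:
  assumes "X \<in> Obj \<D>" "Y \<in> Obj \<D>"
  shows "\<Sigma>m \<D> (zerom \<D> X Y) = zerom \<D> (\<Sigma>o \<D> X) (\<Sigma>o \<D> Y)"
  by (rule zero_unique)
    (use assms shift_add[OF assms zerom_closed zerom_closed] in
      \<open>auto simp: zero_add zerom_closed shift_obj shift_closed\<close>)

lemma vanish_shift_iff:
  assumes "X \<in> Obj \<D>" "Y \<in> Obj \<D>"
  shows "vanish (\<Sigma>o \<D> X) (\<Sigma>o \<D> Y) \<longleftrightarrow> vanish X Y"
proof
  assume v: "vanish (\<Sigma>o \<D> X) (\<Sigma>o \<D> Y)"
  show "vanish X Y"
  proof (rule vanishI[OF assms])
    fix f assume f: "f \<in> Hom \<D> X Y"
    show "f = zerom \<D> X Y"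
      by (rule shift_inj[OF assms f zerom_closed[OF assms]])
        (use shift_closed[OF assms f] v shift_zero[OF assms] in simp)
  qed
next
  assume "vanish X Y"
  then show "vanish (\<Sigma>o \<D> X) (\<Sigma>o \<D> Y)"
    using shift_fully_faithful[OF assms] shift_zero[OF assms] by (simp add: bij_betw_def)
qed

text \<open>By \<open>zero_objectI\<close> only endomorphisms of \<open>\<Sigma>N\<close> matter,
  and full faithfulness compares these with endomorphisms of \<open>N\<close>. Objects that are not
  literally translates never enter.\<close>

lemma shift_zero_object:
  assumes "zero_object \<D> N"
  shows "zero_object \<D> (\<Sigma>o \<D> N)"
proof (rule zero_objectI)
  show "\<Sigma>o \<D> N \<in> Obj \<D>" using assms shift_obj by (simp add: zero_object_def)
  show "vanish (\<Sigma>o \<D> N) (\<Sigma>o \<D> N)"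
    using assms vanish_shift_iff by (simp add: zero_object_def)
qed

lemma rotate:
  assumes "dist_triangle \<D> X Y Z f g h"
  shows "dist_triangle \<D> Y Z (\<Sigma>o \<D> X) g h (neg (\<Sigma>o \<D> X) (\<Sigma>o \<D> Y) (\<Sigma>m \<D> f))"
  using TR2[OF triangleD[OF assms]] assms by blast

lemma tri_rotate: "tri X Y Z \<Longrightarrow> tri Y Z (\<Sigma>o \<D> X)"
  using rotate by blast

text \<open>Fullness of \<Sigma> makes the negative of the last morphism a translate
  \<open>\<Sigma>f\<close>, so the triangle has the exact form in which (TR2) can be read
  backwards.\<close>

lemma tri_rotate_back:
  assumes "X \<in> Obj \<D>" "tri Y Z (\<Sigma>o \<D> X)"
  shows "tri X Y Z"
proof -
  from assms(2) obtain g h k where t: "dist_triangle \<D> Y Z (\<Sigma>o \<D> X) g h k" by blast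
  note d = triangleD[OF t]
  have oX: "\<Sigma>o \<D> X \<in> Obj \<D>" and oY: "\<Sigma>o \<D> Y \<in> Obj \<D>" using shift_obj assms d by auto
  obtain f where f: "f \<in> Hom \<D> X Y" and "neg (\<Sigma>o \<D> X) (\<Sigma>o \<D> Y) k = \<Sigma>m \<D> f"
    using shift_full[OF assms(1) d(1) neg_closed[OF oX oY d(6)]] by metis
  then have "k = neg (\<Sigma>o \<D> X) (\<Sigma>o \<D> Y) (\<Sigma>m \<D> f)"
    using neg_neg[OF oX oY d(6)] by simp
  then show ?thesis using TR2[OF assms(1) d(1,2) f d(4,5)] t by blast
qed

lemma tri_shift: "tri X Y Z \<Longrightarrow> tri (\<Sigma>o \<D> X) (\<Sigma>o \<D> Y) (\<Sigma>o \<D> Z)"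
  by (rule tri_rotate[OF tri_rotate[OF tri_rotate]])

lemma tri_unshift:
  assumes "X \<in> Obj \<D>" "Y \<in> Obj \<D>" "Z \<in> Obj \<D>" "tri (\<Sigma>o \<D> X) (\<Sigma>o \<D> Y) (\<Sigma>o \<D> Z)"
  shows "tri X Y Z"
  by (rule tri_rotate_back[OF assms(1) tri_rotate_back[OF assms(2) tri_rotate_back[OF assms(3,4)]]])

text \<open>The morphisms of the new triangle are the old ones conjugated by the isomorphisms, which
  makes the squares of \<open>TR1_iso\<close> commute.\<close>

lemma tri_iso:
  assumes "tri X Y Z" "iso_obj \<D> X X'" "iso_obj \<D> Y Y'" "iso_obj \<D> Z Z'"
  shows "tri X' Y' Z'"
proof -
  from assms(1) obtain f g h where t: "dist_triangle \<D> X Y Z f g h" by blast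
  note d = triangleD[OF t]
  from assms(2) obtain a a' where oX: "X' \<in> Obj \<D>" and ia: "iso_hom \<D> X X' a"
    and a: "a \<in> Hom \<D> X X'" and a': "a' \<in> Hom \<D> X' X" and aa: "a' \<cdot> a = idt \<D> X"
    unfolding iso_obj_def iso_hom_def by blast
  from assms(3) obtain b b' where oY: "Y' \<in> Obj \<D>" and ib: "iso_hom \<D> Y Y' b"
    and b: "b \<in> Hom \<D> Y Y'" and b': "b' \<in> Hom \<D> Y' Y" and bb: "b' \<cdot> b = idt \<D> Y"
    unfolding iso_obj_def iso_hom_def by blast
  from assms(4) obtain c c' where oZ: "Z' \<in> Obj \<D>" and ic: "iso_hom \<D> Z Z' c"
    and c: "c \<in> Hom \<D> Z Z'" and c': "c' \<in> Hom \<D> Z' Z" and cc: "c' \<cdot> c = idt \<D> Z"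
    unfolding iso_obj_def iso_hom_def by blast
  have oS: "\<Sigma>o \<D> X \<in> Obj \<D>" "\<Sigma>o \<D> X' \<in> Obj \<D>" using shift_obj oX d(1) by auto
  have sa: "\<Sigma>m \<D> a \<in> Hom \<D> (\<Sigma>o \<D> X) (\<Sigma>o \<D> X')" by (rule shift_closed[OF d(1) oX a])
  have bf: "b \<cdot> f \<in> Hom \<D> X Y'" by (rule cmp_closed[OF d(1,2) oY d(4) b])
  have cg: "c \<cdot> g \<in> Hom \<D> Y Z'" by (rule cmp_closed[OF d(2,3) oZ d(5) c])
  have ah: "\<Sigma>m \<D> a \<cdot> h \<in> Hom \<D> Z (\<Sigma>o \<D> X')" by (rule cmp_closed[OF d(3) oS d(6) sa])
  have "dist_triangle \<D> X' Y' Z' ((b \<cdot> f) \<cdot> a') ((c \<cdot> g) \<cdot> b') ((\<Sigma>m \<D> a \<cdot> h) \<cdot> c')"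
  proof (rule TR1_iso[OF t oX oY oZ _ _ _ ia ib ic])
    show "(b \<cdot> f) \<cdot> a' \<in> Hom \<D> X' Y'" by (rule cmp_closed[OF oX d(1) oY a' bf])
    show "(c \<cdot> g) \<cdot> b' \<in> Hom \<D> Y' Z'" by (rule cmp_closed[OF oY d(2) oZ b' cg])
    show "(\<Sigma>m \<D> a \<cdot> h) \<cdot> c' \<in> Hom \<D> Z' (\<Sigma>o \<D> X')" by (rule cmp_closed[OF oZ d(3) oS(2) c' ah])
    show "(b \<cdot> f) \<cdot> a' \<cdot> a = b \<cdot> f"
      using cmp_assoc[OF d(1) oX d(1) oY a a' bf] aa idt_right[OF d(1) oY bf] by simp
    show "(c \<cdot> g) \<cdot> b' \<cdot> b = c \<cdot> g"
      using cmp_assoc[OF d(2) oY d(2) oZ b b' cg] bb idt_right[OF d(2) oZ cg] by simp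
    show "(\<Sigma>m \<D> a \<cdot> h) \<cdot> c' \<cdot> c = \<Sigma>m \<D> a \<cdot> h"
      using cmp_assoc[OF d(3) oZ d(3) oS(2) c c' ah] cc idt_right[OF d(3) oS(2) ah] by simp
  qed
  then show ?thesis by blast
qed

text \<open>Exactness of Hom(W, -) at the middle term. (TR3) completes a morphism from the rotated
  identity triangle of \<open>W\<close> to the rotated given triangle, and full faithfulness of
  \<Sigma> turns the completion into the required lift.\<close>

lemma exact_covariant:
  assumes t: "dist_triangle \<D> X Y Z f g h" and W: "W \<in> Obj \<D>" and u: "u \<in> Hom \<D> W Y"
    and gu: "g \<cdot> u = zerom \<D> W Z"
  shows "\<exists>v \<in> Hom \<D> W X. f \<cdot> v = u"
proof -
  note d = triangleD[OF t]
  have oS: "\<Sigma>o \<D> W \<in> Obj \<D>" "\<Sigma>o \<D> X \<in> Obj \<D>" "\<Sigma>o \<D> Y \<in> Obj \<D>" using shift_obj W d by auto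
  obtain N where N: "zero_object \<D> N" using ex_zero_object by blast
  then have oN: "N \<in> Obj \<D>" by (simp add: zero_object_def)
  \<comment> \<open>This is the triangle W -> N -> \<Sigma>W; its map to Y -> Z -> \<Sigma>X starts
    with \<open>u\<close> and the zero morphism, compatible because \<open>g\<close> kills
    \<open>u\<close>.\<close>
  note s = rotate[OF TR1_idt[OF W N]]
  obtain c where c: "c \<in> Hom \<D> (\<Sigma>o \<D> W) (\<Sigma>o \<D> X)"
    and e: "neg (\<Sigma>o \<D> X) (\<Sigma>o \<D> Y) (\<Sigma>m \<D> f) \<cdot> c
            = \<Sigma>m \<D> u \<cdot> neg (\<Sigma>o \<D> W) (\<Sigma>o \<D> W) (\<Sigma>m \<D> (idt \<D> W))"
    using TR3[OF s rotate[OF t] u zerom_closed[OF oN d(3)]] gu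
      cmp_zero_right[OF W oN d(3) zerom_closed[OF oN d(3)]] by auto
  obtain v where v: "v \<in> Hom \<D> W X" and cv: "c = \<Sigma>m \<D> v" using shift_full[OF W d(1) c] by blast
  have fv: "f \<cdot> v \<in> Hom \<D> W Y" by (rule cmp_closed[OF W d(1,2) v d(4)])
  have sf: "\<Sigma>m \<D> f \<in> Hom \<D> (\<Sigma>o \<D> X) (\<Sigma>o \<D> Y)" and su: "\<Sigma>m \<D> u \<in> Hom \<D> (\<Sigma>o \<D> W) (\<Sigma>o \<D> Y)"
    and sfv: "\<Sigma>m \<D> (f \<cdot> v) \<in> Hom \<D> (\<Sigma>o \<D> W) (\<Sigma>o \<D> Y)"
    using shift_closed d W u fv by auto
  \<comment> \<open>Both rotated triangles carry one sign, so the two sides are negatives and the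
    signs cancel.\<close>
  have "neg (\<Sigma>o \<D> W) (\<Sigma>o \<D> Y) (\<Sigma>m \<D> (f \<cdot> v)) = neg (\<Sigma>o \<D> W) (\<Sigma>o \<D> Y) (\<Sigma>m \<D> u)"
    using e cmp_neg_left[OF oS c sf] cv shift_cmp[OF W d(1,2) v d(4)] shift_idt[OF W]
      cmp_neg_right[OF oS(1,1,3) idt_closed[OF oS(1)] su] idt_right[OF oS(1,3) su] by simp
  then have "\<Sigma>m \<D> (f \<cdot> v) = \<Sigma>m \<D> u"
    using neg_neg[OF oS(1,3) sfv] neg_neg[OF oS(1,3) su] by metis
  then show ?thesis using shift_inj[OF W d(2) fv u] v by blast
qed

text \<open>Exactness of Hom(-, W) at the middle term: (TR3) maps the given triangle to N -> W -> W
  with \<open>N\<close> a zero object, and the third component is the required factor of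
  \<open>u\<close>.\<close>

lemma exact_contravariant:
  assumes t: "dist_triangle \<D> X Y Z f g h" and W: "W \<in> Obj \<D>" and u: "u \<in> Hom \<D> Y W"
    and uf: "u \<cdot> f = zerom \<D> X W"
  shows "\<exists>v \<in> Hom \<D> Z W. v \<cdot> g = u"
proof -
  note d = triangleD[OF t]
  obtain N where N: "zero_object \<D> N" using ex_zero_object by blast
  then have oN: "N \<in> Obj \<D>" by (simp add: zero_object_def)
  note SN = shift_zero_object[OF N]
  have oS: "\<Sigma>o \<D> W \<in> Obj \<D>" "\<Sigma>o \<D> N \<in> Obj \<D>" using shift_obj W oN by auto
  \<comment> \<open>The triangle N -> W -> W comes from the identity triangle W -> W -> \<Sigma>N by
    reading (TR2) backwards; the last morphism must be a negated translate, which is zero because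
    \<open>\<Sigma>N\<close> is a zero object.\<close>
  have "neg (\<Sigma>o \<D> N) (\<Sigma>o \<D> W) (\<Sigma>m \<D> (zerom \<D> N W)) = zerom \<D> (\<Sigma>o \<D> N) (\<Sigma>o \<D> W)"
    using SN neg_closed[OF oS(2,1) shift_closed[OF oN W zerom_closed[OF oN W]]] oS
    by (simp add: zero_object_def)
  then have "dist_triangle \<D> N W W (zerom \<D> N W) (idt \<D> W) (zerom \<D> W (\<Sigma>o \<D> N))"
    using TR2[OF oN W W zerom_closed[OF oN W] idt_closed[OF W] zerom_closed[OF W oS(2)]]
      TR1_idt[OF W SN] by simp
  from TR3[OF t this zerom_closed[OF d(1) oN] u]
  obtain c where "c \<in> Hom \<D> Z W" "idt \<D> W \<cdot> u = c \<cdot> g"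
    using uf cmp_zero_right[OF d(1) oN W zerom_closed[OF oN W]] by auto
  then show ?thesis using idt_left[OF d(2) W u] by metis
qed

text \<open>By exactness a morphism to \<open>Y\<close> lifts to \<open>X\<close>, where it must be
  zero.\<close>

lemma vanish_to_middle:
  assumes "tri X Y Z" "W \<in> Obj \<D>" "vanish W X" "vanish W Z"
  shows "vanish W Y"
proof -
  from assms(1) obtain f g h where t: "dist_triangle \<D> X Y Z f g h" by blast
  note d = triangleD[OF t]
  show ?thesis
  proof (rule vanishI[OF assms(2) d(2)])
    fix u assume u: "u \<in> Hom \<D> W Y"
    have "g \<cdot> u = zerom \<D> W Z" using cmp_closed[OF assms(2) d(2,3) u d(5)] assms(4) by simp
    from exact_covariant[OF t assms(2) u this] show "u = zerom \<D> W Y"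
      using assms(3) cmp_zero_right[OF assms(2) d(1,2,4)] by auto
  qed
qed

lemma vanish_from_middle:
  assumes "tri X Y Z" "W \<in> Obj \<D>" "vanish X W" "vanish Z W"
  shows "vanish Y W"
proof -
  from assms(1) obtain f g h where t: "dist_triangle \<D> X Y Z f g h" by blast
  note d = triangleD[OF t]
  show ?thesis
  proof (rule vanishI[OF d(2) assms(2)])
    fix u assume u: "u \<in> Hom \<D> Y W"
    have "u \<cdot> f = zerom \<D> X W" using cmp_closed[OF d(1,2) assms(2) d(4) u] assms(3) by simp
    from exact_contravariant[OF t assms(2) u this] show "u = zerom \<D> Y W"
      using assms(4) cmp_zero_left[OF d(2,3) assms(2) d(5)] by auto
  qed
qed

text \<open>The first morphism \<open>f\<close> is invertible. Since \<open>g\<close> is zero, the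
  identity of \<open>Y\<close> lifts along \<open>f\<close>; since \<open>h\<close> is zero, the
  identity of \<open>\<Sigma>X\<close> extends along the rotated morphism, which desuspends to a
  left inverse of \<open>f\<close>.\<close>

lemma tri_zero_right:
  assumes "tri X Y Z" "vanish Z Z"
  shows "iso_obj \<D> X Y"
proof -
  from assms(1) obtain f g h where t: "dist_triangle \<D> X Y Z f g h" by blast
  note d = triangleD[OF t]
  have oS: "\<Sigma>o \<D> X \<in> Obj \<D>" "\<Sigma>o \<D> Y \<in> Obj \<D>" using shift_obj d by auto
  have zZ: "zero_object \<D> Z" using zero_objectI[OF d(3) assms(2)] .
  have "g \<cdot> idt \<D> Y = zerom \<D> Y Z"
    using idt_right[OF d(2,3,5)] d(2,5) zZ by (auto simp: zero_object_def)
  then obtain v where v: "v \<in> Hom \<D> Y X" and fv: "f \<cdot> v = idt \<D> Y"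
    using exact_covariant[OF t d(2) idt_closed[OF d(2)]] by blast
  have "idt \<D> (\<Sigma>o \<D> X) \<cdot> h = zerom \<D> Z (\<Sigma>o \<D> X)"
    using idt_left[OF d(3) oS(1) d(6)] d(6) oS(1) zZ by (auto simp: zero_object_def)
  then obtain w where w: "w \<in> Hom \<D> (\<Sigma>o \<D> Y) (\<Sigma>o \<D> X)"
    and wf: "w \<cdot> neg (\<Sigma>o \<D> X) (\<Sigma>o \<D> Y) (\<Sigma>m \<D> f) = idt \<D> (\<Sigma>o \<D> X)"
    using exact_contravariant[OF rotate[OF rotate[OF t]] oS(1) idt_closed[OF oS(1)]] by blast
  \<comment> \<open>The rotated morphism is the negative of \<open>\<Sigma>f\<close>; the sign is
    moved into the left inverse.\<close>
  define w' where "w' = neg (\<Sigma>o \<D> Y) (\<Sigma>o \<D> X) w"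
  have w': "w' \<in> Hom \<D> (\<Sigma>o \<D> Y) (\<Sigma>o \<D> X)" unfolding w'_def by (rule neg_closed[OF oS(2,1) w])
  have sf: "\<Sigma>m \<D> f \<in> Hom \<D> (\<Sigma>o \<D> X) (\<Sigma>o \<D> Y)" by (rule shift_closed[OF d(1,2,4)])
  have "w' \<cdot> \<Sigma>m \<D> f = idt \<D> (\<Sigma>o \<D> X)"
    using wf cmp_neg_right[OF oS oS(1) sf w] cmp_neg_left[OF oS oS(1) sf w] w'_def by simp
  moreover obtain x where x: "x \<in> Hom \<D> Y X" "w' = \<Sigma>m \<D> x" using shift_full[OF d(2,1) w'] .
  ultimately have "\<Sigma>m \<D> (x \<cdot> f) = \<Sigma>m \<D> (idt \<D> X)"
    using shift_cmp[OF d(1,2,1,4) x(1)] shift_idt[OF d(1)] by simp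
  then have xf: "x \<cdot> f = idt \<D> X"
    using shift_inj[OF d(1,1) cmp_closed[OF d(1,2,1,4) x(1)] idt_closed[OF d(1)]] by blast
  have "x = x \<cdot> (f \<cdot> v)" using fv idt_right[OF d(2,1) x(1)] by simp
  also have "\<dots> = v"
    using cmp_assoc[OF d(2,1,2,1) v d(4) x(1)] xf idt_left[OF d(2,1) v] by simp
  finally show ?thesis
    unfolding iso_obj_def iso_hom_def using d v fv xf by blast
qed

lemma tri_zero_left:
  assumes "tri X Y Z" "vanish X X"
  shows "iso_obj \<D> Y Z"
proof (rule tri_zero_right[OF tri_rotate[OF assms(1)]])
  show "vanish (\<Sigma>o \<D> X) (\<Sigma>o \<D> X)"
    using assms vanish_shift_iff triangleD(1) by metis
qed

section \<open>Extensions of subcategories\<close>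

lemma star_replete:
  assumes "replete_subcat \<D> A" "replete_subcat \<D> B"
  shows "replete_subcat \<D> (A \<star> B)"
proof -
  have "Y \<in> A \<star> B" if "X \<in> A \<star> B" "iso_obj \<D> X Y" for X Y
  proof -
    from that(1) obtain P Q where PQ: "P \<in> A" "Q \<in> B" "tri P X Q" unfolding star_def by blast
    have "tri P Y Q"
      by (rule tri_iso[OF PQ(3) iso_obj_refl that(2) iso_obj_refl])
        (use PQ assms in \<open>auto simp: replete_subcat_def\<close>)
    then show ?thesis using PQ unfolding star_def by blast
  qed
  moreover have "A \<star> B \<subseteq> Obj \<D>" unfolding star_def using triangleD(2) by blast
  ultimately show ?thesis unfolding replete_subcat_def by blast
qed

lemma star_mono: "A \<subseteq> A' \<Longrightarrow> B \<subseteq> B' \<Longrightarrow> A \<star> B \<subseteq> A' \<star> B'"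
  unfolding star_def by blast

text \<open>Octahedral axiom for P -> E -> W: the cones \<open>Q\<close> and \<open>S\<close> of the
  two factors and the cone \<open>F\<close> of the composite form a triangle Q -> F -> S.\<close>

lemma star_assoc_left: "(A \<star> B) \<star> C \<subseteq> A \<star> (B \<star> C)"
proof
  fix W assume "W \<in> (A \<star> B) \<star> C"
  then obtain P Q S E u a b v c d where PQ: "P \<in> A" "Q \<in> B" "S \<in> C"
    and u: "dist_triangle \<D> P E Q u a b" and v: "dist_triangle \<D> E W S v c d"
    unfolding star_def by blast
  note du = triangleD[OF u] and dv = triangleD[OF v]
  obtain F e k where "dist_triangle \<D> P W F (v \<cdot> u) e k"
    using TR1_cone[OF du(1) dv(2) cmp_closed[OF du(1,2) dv(2) du(4) dv(4)]] by blast
  then show "W \<in> A \<star> (B \<star> C)" using TR4[OF u v] PQ unfolding star_def by blast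
qed

text \<open>Octahedral axiom for W -> E -> S, whose factors have cones \<open>\<Sigma>P\<close> and
  \<open>\<Sigma>Q\<close>. The intermediate object is the desuspension of the cone of the
  composite.\<close>

lemma star_assoc_right: "A \<star> (B \<star> C) \<subseteq> (A \<star> B) \<star> C"
proof
  fix W assume "W \<in> A \<star> (B \<star> C)"
  then obtain P Q S E where PQ: "P \<in> A" "Q \<in> B" "S \<in> C" and s: "tri P W E" and t: "tri Q E S"
    unfolding star_def by blast
  obtain u a b where u: "dist_triangle \<D> W E (\<Sigma>o \<D> P) u a b" using tri_rotate[OF s] by blast
  obtain v c d where v: "dist_triangle \<D> E S (\<Sigma>o \<D> Q) v c d" using tri_rotate[OF t] by blast
  have o: "P \<in> Obj \<D>" "Q \<in> Obj \<D>" using s t triangleD(1) by blast+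
  note du = triangleD[OF u] and dv = triangleD[OF v]
  obtain F e k where F: "dist_triangle \<D> W S F (v \<cdot> u) e k"
    using TR1_cone[OF du(1) dv(2) cmp_closed[OF du(1,2) dv(2) du(4) dv(4)]] by blast
  then have F2: "tri (\<Sigma>o \<D> P) F (\<Sigma>o \<D> Q)" using TR4[OF u v] by blast
  \<comment> \<open>\<open>G\<close> stands for the inverse translate of \<open>F\<close>, available
    only up to isomorphism since \<Sigma> is merely essentially surjective.\<close>
  obtain G where G: "G \<in> Obj \<D>" "iso_obj \<D> (\<Sigma>o \<D> G) F"
    using shift_ess_surj triangleD(3)[OF F] by blast
  note FG = iso_obj_sym[OF G(2)]
  have "tri P G Q"
    by (rule tri_unshift[OF o(1) G(1) o(2) tri_iso[OF F2 iso_obj_refl FG iso_obj_refl]])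
      (use o shift_obj in auto)
  moreover have "tri G W S"
    using tri_rotate_back[OF G(1)] tri_iso[OF _ iso_obj_refl iso_obj_refl FG] F du(1) dv(2) by blast
  ultimately show "W \<in> (A \<star> B) \<star> C" using PQ unfolding star_def by blast
qed

section \<open>Shifts of subcategories\<close>

lemma shift_subcat_1:
  "shift_subcat \<D> 1 A = {Y \<in> Obj \<D>. \<exists>X \<in> A. iso_obj \<D> (\<Sigma>o \<D> X) Y}"
  by (simp add: shift_subcat_def)

lemma shift_subcat_minus_1:
  "shift_subcat \<D> (-1) A = {Y \<in> Obj \<D>. \<exists>X \<in> A. iso_obj \<D> X (\<Sigma>o \<D> Y)}"
  by (simp add: shift_subcat_def)

lemma shift_subcat_minus_1_iff:
  assumes "replete_subcat \<D> A" "Y \<in> Obj \<D>"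
  shows "Y \<in> shift_subcat \<D> (-1) A \<longleftrightarrow> \<Sigma>o \<D> Y \<in> A"
proof
  assume "Y \<in> shift_subcat \<D> (-1) A"
  then show "\<Sigma>o \<D> Y \<in> A"
    using assms(1) unfolding shift_subcat_minus_1 replete_subcat_def by blast
next
  assume "\<Sigma>o \<D> Y \<in> A"
  then show "Y \<in> shift_subcat \<D> (-1) A"
    using assms(2) iso_obj_refl[OF shift_obj[OF assms(2)]] unfolding shift_subcat_minus_1 by blast
qed

text \<open>Triangles can be suspended and, up to isomorphism, desuspended. Together with
  \<open>star_shift_1\<close> this turns (T1'), a statement on products of shifts, into a statement
  on shifts of products.\<close>

lemma star_shift_minus_1:
  assumes A: "replete_subcat \<D> A" and B: "replete_subcat \<D> B"
  shows "shift_subcat \<D> (-1) A \<star> shift_subcat \<D> (-1) B = shift_subcat \<D> (-1) (A \<star> B)"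
proof (intro equalityI subsetI)
  fix W assume "W \<in> shift_subcat \<D> (-1) A \<star> shift_subcat \<D> (-1) B"
  then obtain P Q where PQ: "P \<in> shift_subcat \<D> (-1) A" "Q \<in> shift_subcat \<D> (-1) B"
    and t: "tri P W Q" unfolding star_def by blast
  have o: "P \<in> Obj \<D>" "W \<in> Obj \<D>" "Q \<in> Obj \<D>" using t triangleD by blast+
  have "\<Sigma>o \<D> P \<in> A" "\<Sigma>o \<D> Q \<in> B" using PQ o shift_subcat_minus_1_iff A B by blast+
  then have "\<Sigma>o \<D> W \<in> A \<star> B" using tri_shift[OF t] unfolding star_def by blast
  then show "W \<in> shift_subcat \<D> (-1) (A \<star> B)"
    using shift_subcat_minus_1_iff[OF star_replete[OF A B] o(2)] by blast
next
  fix W assume W: "W \<in> shift_subcat \<D> (-1) (A \<star> B)"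
  then have oW: "W \<in> Obj \<D>" by (simp add: shift_subcat_def)
  then have "\<Sigma>o \<D> W \<in> A \<star> B" using W shift_subcat_minus_1_iff[OF star_replete[OF A B]] by blast
  then obtain P Q where PQ: "P \<in> A" "Q \<in> B" and t: "tri P (\<Sigma>o \<D> W) Q"
    unfolding star_def by blast
  obtain P' where P': "P' \<in> Obj \<D>" "iso_obj \<D> (\<Sigma>o \<D> P') P"
    using shift_ess_surj t triangleD(1) by blast
  obtain Q' where Q': "Q' \<in> Obj \<D>" "iso_obj \<D> (\<Sigma>o \<D> Q') Q"
    using shift_ess_surj t triangleD(3) by blast
  have "tri P' W Q'"
    by (rule tri_unshift[OF P'(1) oW Q'(1)
          tri_iso[OF t iso_obj_sym[OF P'(2)] iso_obj_refl[OF shift_obj[OF oW]] iso_obj_sym[OF Q'(2)]]])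
  moreover have "P' \<in> shift_subcat \<D> (-1) A" "Q' \<in> shift_subcat \<D> (-1) B"
    using PQ P' Q' iso_obj_sym unfolding shift_subcat_minus_1 by blast+
  ultimately show "W \<in> shift_subcat \<D> (-1) A \<star> shift_subcat \<D> (-1) B"
    unfolding star_def by blast
qed

lemma star_shift_1:
  assumes A: "A \<subseteq> Obj \<D>" and B: "B \<subseteq> Obj \<D>"
  shows "shift_subcat \<D> 1 A \<star> shift_subcat \<D> 1 B = shift_subcat \<D> 1 (A \<star> B)"
proof (intro equalityI subsetI)
  fix W assume "W \<in> shift_subcat \<D> 1 A \<star> shift_subcat \<D> 1 B"
  then obtain P Q P' Q' where PQ: "P' \<in> A" "Q' \<in> B" "iso_obj \<D> (\<Sigma>o \<D> P') P"
    "iso_obj \<D> (\<Sigma>o \<D> Q') Q" and t: "tri P W Q"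
    unfolding star_def shift_subcat_1 by blast
  have o: "P' \<in> Obj \<D>" "Q' \<in> Obj \<D>" "W \<in> Obj \<D>" using PQ A B t triangleD(2) by blast+
  obtain W' where W': "W' \<in> Obj \<D>" "iso_obj \<D> (\<Sigma>o \<D> W') W" using shift_ess_surj o(3) by blast
  have "tri P' W' Q'"
    by (rule tri_unshift[OF o(1) W'(1) o(2)
          tri_iso[OF t iso_obj_sym[OF PQ(3)] iso_obj_sym[OF W'(2)] iso_obj_sym[OF PQ(4)]]])
  then show "W \<in> shift_subcat \<D> 1 (A \<star> B)"
    using PQ W' o unfolding star_def shift_subcat_1 by blast
next
  fix W assume "W \<in> shift_subcat \<D> 1 (A \<star> B)"
  then obtain W' P Q where W: "W \<in> Obj \<D>" "iso_obj \<D> (\<Sigma>o \<D> W') W" and PQ: "P \<in> A" "Q \<in> B"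
    and t: "tri P W' Q" unfolding star_def shift_subcat_1 by blast
  have o: "\<Sigma>o \<D> P \<in> Obj \<D>" "\<Sigma>o \<D> Q \<in> Obj \<D>" using PQ A B shift_obj by blast+
  have "tri (\<Sigma>o \<D> P) W (\<Sigma>o \<D> Q)"
    by (rule tri_iso[OF tri_shift[OF t] iso_obj_refl[OF o(1)] W(2) iso_obj_refl[OF o(2)]])
  then show "W \<in> shift_subcat \<D> 1 A \<star> shift_subcat \<D> 1 B"
    using PQ o iso_obj_refl unfolding star_def shift_subcat_1 by blast
qed

text \<open>Both inclusions say that \<open>A\<close> is stable under \<Sigma>; (T1') yields the
  first form, (T1) uses the second.\<close>

lemma shift_subset_iff:
  assumes "replete_subcat \<D> A"
  shows "A \<subseteq> shift_subcat \<D> (-1) A \<longleftrightarrow> shift_subcat \<D> 1 A \<subseteq> A"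
proof
  assume "A \<subseteq> shift_subcat \<D> (-1) A"
  then have "\<Sigma>o \<D> X \<in> A" if "X \<in> A" for X
    using that shift_subcat_minus_1_iff[OF assms] assms unfolding replete_subcat_def by blast
  then show "shift_subcat \<D> 1 A \<subseteq> A"
    using assms unfolding shift_subcat_1 replete_subcat_def by blast
next
  assume s: "shift_subcat \<D> 1 A \<subseteq> A"
  show "A \<subseteq> shift_subcat \<D> (-1) A"
  proof
    fix X assume X: "X \<in> A"
    then have o: "X \<in> Obj \<D>" using assms unfolding replete_subcat_def by blast
    have "\<Sigma>o \<D> X \<in> A"
      using s X shift_obj[OF o] iso_obj_refl[OF shift_obj[OF o]] unfolding shift_subcat_1 by blast
    then show "X \<in> shift_subcat \<D> (-1) A" using shift_subcat_minus_1_iff[OF assms o] by blast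
  qed
qed

text \<open>Exactness is used first in the target, then in the source.\<close>

lemma orthogonal_star:
  assumes "hom_orthogonal \<D> A C" "hom_orthogonal \<D> A E"
    "hom_orthogonal \<D> B C" "hom_orthogonal \<D> B E"
  shows "hom_orthogonal \<D> (A \<star> B) (C \<star> E)"
  unfolding hom_orthogonal_def
proof (intro ballI)
  fix X Y assume "X \<in> A \<star> B" "Y \<in> C \<star> E"
  then obtain P Q S T where PQ: "P \<in> A" "Q \<in> B" "S \<in> C" "T \<in> E" and t: "tri P X Q" "tri S Y T"
    unfolding star_def by blast
  have o: "P \<in> Obj \<D>" "Q \<in> Obj \<D>" "Y \<in> Obj \<D>" using t triangleD by blast+
  have "vanish P Y"
    by (rule vanish_to_middle[OF t(2) o(1)]) (use PQ assms in \<open>auto simp: hom_orthogonal_def\<close>)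
  moreover have "vanish Q Y"
    by (rule vanish_to_middle[OF t(2) o(2)]) (use PQ assms in \<open>auto simp: hom_orthogonal_def\<close>)
  ultimately show "vanish X Y" using vanish_from_middle[OF t(1) o(3)] by blast
qed

section \<open>Closure properties of t-structures\<close>

lemma t_structureD:
  assumes "t_structure \<D> (L, R)"
  shows "replete_subcat \<D> L" "replete_subcat \<D> R" "L \<subseteq> Obj \<D>" "R \<subseteq> Obj \<D>"
    "shift_subcat \<D> 1 L \<subseteq> L" "R \<subseteq> shift_subcat \<D> 1 R"
    "X \<in> L \<Longrightarrow> Y \<in> R \<Longrightarrow> vanish X Y"
    "X \<in> Obj \<D> \<Longrightarrow> X \<in> L \<star> R"
  using assms unfolding t_structure_def hom_orthogonal_def replete_subcat_def star_def by auto

lemma t_structure_shift: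
  assumes t: "t_structure \<D> (L, R)" and "X \<in> L"
  shows "\<Sigma>o \<D> X \<in> L"
  using t_structureD(3,5)[OF t] assms(2) shift_obj iso_obj_refl unfolding shift_subcat_1 by blast

text \<open>In a truncation triangle P -> X -> Q, the rotated triangle Q -> \<Sigma>P -> \<Sigma>X
  shows that \<open>\<Sigma>P\<close> has only the zero endomorphism: \<open>\<Sigma>P\<close> is in
  \<open>L\<close>, and P -> X vanishes by assumption. Hence \<open>P\<close> is zero and
  \<open>X\<close> is isomorphic to \<open>Q\<close>.\<close>

lemma t_structure_right_iff:
  assumes t: "t_structure \<D> (L, R)" and X: "X \<in> Obj \<D>"
  shows "X \<in> R \<longleftrightarrow> (\<forall>W \<in> L. vanish W X)"
proof
  assume *: "\<forall>W \<in> L. vanish W X"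
  obtain P Q where PQ: "P \<in> L" "Q \<in> R" and s: "tri P X Q"
    using t_structureD(8)[OF t X] unfolding star_def by blast
  have o: "P \<in> Obj \<D>" "\<Sigma>o \<D> P \<in> Obj \<D>" using PQ t_structureD(3)[OF t] shift_obj by blast+
  have "vanish (\<Sigma>o \<D> P) (\<Sigma>o \<D> P)"
  proof (rule vanish_to_middle[OF tri_rotate[OF tri_rotate[OF s]] o(2)])
    show "vanish (\<Sigma>o \<D> P) Q" using t_structureD(7)[OF t] t_structure_shift[OF t] PQ by blast
    show "vanish (\<Sigma>o \<D> P) (\<Sigma>o \<D> X)" using * PQ vanish_shift_iff[OF o(1) X] by blast
  qed
  then have "iso_obj \<D> X Q" using vanish_shift_iff[OF o(1) o(1)] tri_zero_left[OF s] by blast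
  then show "X \<in> R"
    using PQ iso_obj_sym t_structureD(2)[OF t] unfolding replete_subcat_def by blast
qed (use t_structureD(7)[OF t] in blast)

text \<open>In the truncation triangle, exactness along X -> Q -> \<Sigma>P kills the endomorphisms
  of \<open>Q\<close>, so \<open>X\<close> is isomorphic to \<open>P\<close>.\<close>

lemma t_structure_left_iff:
  assumes t: "t_structure \<D> (L, R)" and X: "X \<in> Obj \<D>"
  shows "X \<in> L \<longleftrightarrow> (\<forall>W \<in> R. vanish X W)"
proof
  assume *: "\<forall>W \<in> R. vanish X W"
  obtain P Q where PQ: "P \<in> L" "Q \<in> R" and s: "tri P X Q"
    using t_structureD(8)[OF t X] unfolding star_def by blast
  have o: "Q \<in> Obj \<D>" using PQ t_structureD(4)[OF t] by blast
  have "vanish Q Q"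
  proof (rule vanish_from_middle[OF tri_rotate[OF s] o])
    show "vanish X Q" using * PQ by blast
    show "vanish (\<Sigma>o \<D> P) Q" using t_structureD(7)[OF t] t_structure_shift[OF t] PQ by blast
  qed
  then have "iso_obj \<D> P X" using tri_zero_right[OF s] by blast
  then show "X \<in> L"
    using PQ t_structureD(1)[OF t] unfolding replete_subcat_def by blast
qed (use t_structureD(7)[OF t] in blast)

lemma t_structure_left_ext:
  assumes t: "t_structure \<D> (L, R)" and s: "tri X Y Z" and "X \<in> L" "Z \<in> L"
  shows "Y \<in> L"
proof -
  have Y: "Y \<in> Obj \<D>" using s triangleD(2) by blast
  show ?thesis
    unfolding t_structure_left_iff[OF t Y]
    using vanish_from_middle[OF s] t_structureD(4,7)[OF t] assms(3,4) by blast
qed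

lemma t_structure_right_ext:
  assumes t: "t_structure \<D> (L, R)" and s: "tri X Y Z" and "X \<in> R" "Z \<in> R"
  shows "Y \<in> R"
proof -
  have Y: "Y \<in> Obj \<D>" using s triangleD(2) by blast
  show ?thesis
    unfolding t_structure_right_iff[OF t Y]
    using vanish_to_middle[OF s] t_structureD(3,7)[OF t] assms(3,4) by blast
qed

text \<open>Rotation exhibits \<open>Z\<close> as an extension of \<open>\<Sigma>X\<close> by
  \<open>Y\<close>.\<close>

lemma t_structure_left_cone:
  assumes "t_structure \<D> (L, R)" "tri X Y Z" "X \<in> L" "Y \<in> L"
  shows "Z \<in> L"
  using t_structure_left_ext[OF assms(1) tri_rotate[OF assms(2)]] assms(3,4)
    t_structure_shift[OF assms(1)] by blast

text \<open>Testing \<open>\<Sigma>X\<close> against translates of objects of \<open>L\<close>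
  replaces the desuspension of \<open>Z\<close> that backward rotation would require.\<close>

lemma t_structure_right_cocone:
  assumes t: "t_structure \<D> (L, R)" and s: "tri X Y Z" and "Y \<in> R" "Z \<in> R"
  shows "X \<in> R"
proof -
  have o: "X \<in> Obj \<D>" "Y \<in> Obj \<D>" using s triangleD by blast+
  have "vanish W X" if W: "W \<in> L" for W
  proof -
    have oW: "W \<in> Obj \<D>" using W t_structureD(3)[OF t] by blast
    have "vanish (\<Sigma>o \<D> W) (\<Sigma>o \<D> X)"
    proof (rule vanish_to_middle[OF tri_rotate[OF tri_rotate[OF s]] shift_obj[OF oW]])
      show "vanish (\<Sigma>o \<D> W) Z"
        using t_structureD(7)[OF t] t_structure_shift[OF t] W assms(4) by blast
      show "vanish (\<Sigma>o \<D> W) (\<Sigma>o \<D> Y)"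
        using t_structureD(7)[OF t W assms(3)] vanish_shift_iff[OF oW o(2)] by blast
    qed
    then show ?thesis using vanish_shift_iff[OF oW o(1)] by blast
  qed
  then show ?thesis using t_structure_right_iff[OF t o(1)] by blast
qed

text \<open>Intermediate t-structures are bounded through their left halves only; this supplies the
  bounds on the right halves.\<close>

lemma t_structure_right_antimono:
  assumes "t_structure \<D> (L, R)" "t_structure \<D> (L', R')" "L \<subseteq> L'"
  shows "R' \<subseteq> R"
  using t_structure_right_iff[OF assms(1)] t_structureD(4,7)[OF assms(2)] assms(3) by blast

text \<open>Truncating an object of \<open>L\<close> by the smaller t-structure leaves a cone that
  is again in \<open>L\<close>. For the larger of the two outer t-structures this reads
  \<open>L1 \<star> (R1 \<inter> L2) = L2\<close>.\<close>

lemma t_structure_left_star: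
  assumes t1: "t_structure \<D> (L1, R1)" and t: "t_structure \<D> (L, R)" and "L1 \<subseteq> L"
  shows "L1 \<star> (R1 \<inter> L) = L"
proof (intro equalityI subsetI)
  fix X assume "X \<in> L1 \<star> (R1 \<inter> L)"
  then show "X \<in> L" using t_structure_left_ext[OF t] assms(3) unfolding star_def by blast
next
  fix X assume X: "X \<in> L"
  then have "X \<in> L1 \<star> R1" using t_structureD(3)[OF t] t_structureD(8)[OF t1] by blast
  then obtain P Q where PQ: "P \<in> L1" "Q \<in> R1" "tri P X Q" unfolding star_def by blast
  then have "Q \<in> L" using t_structure_left_cone[OF t PQ(3)] X assms(3) by blast
  then show "X \<in> L1 \<star> (R1 \<inter> L)" using PQ unfolding star_def by blast
qed

lemma t_structure_right_star:
  assumes t: "t_structure \<D> (L, R)" and t2: "t_structure \<D> (L2, R2)" and "R2 \<subseteq> R"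
  shows "(R \<inter> L2) \<star> R2 = R"
proof (intro equalityI subsetI)
  fix X assume "X \<in> (R \<inter> L2) \<star> R2"
  then show "X \<in> R" using t_structure_right_ext[OF t] assms(3) unfolding star_def by blast
next
  fix X assume X: "X \<in> R"
  then have "X \<in> L2 \<star> R2" using t_structureD(4)[OF t] t_structureD(8)[OF t2] by blast
  then obtain P Q where PQ: "P \<in> L2" "Q \<in> R2" "tri P X Q" unfolding star_def by blast
  then have "P \<in> R" using t_structure_right_cocone[OF t PQ(3)] X assms(3) by blast
  then show "X \<in> (R \<inter> L2) \<star> R2" using PQ unfolding star_def by blast
qed

lemma replete_Int:
  "replete_subcat \<D> A \<Longrightarrow> replete_subcat \<D> B \<Longrightarrow> replete_subcat \<D> (A \<inter> B)"
  unfolding replete_subcat_def by blast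

section \<open>The correspondence\<close>

text \<open>The index conventions make \<open>sub_le\<close> at 1 the shift by -1 and
  \<open>sub_ge\<close> at 0 the shift by 1; (T3') becomes an inclusion in
  \<open>U \<star> V\<close>.\<close>

lemma t_structure_on_heart_iff:
  "t_structure_on_heart \<D> (L1, R1) (L2, R2) (U, V) \<longleftrightarrow>
     U \<subseteq> R1 \<inter> L2 \<and> V \<subseteq> R1 \<inter> L2 \<and> replete_subcat \<D> U \<and> replete_subcat \<D> V \<and>
     L1 \<star> U \<subseteq> shift_subcat \<D> (-1) L1 \<star> shift_subcat \<D> (-1) U \<and>
     V \<star> R2 \<subseteq> shift_subcat \<D> 1 V \<star> shift_subcat \<D> 1 R2 \<and>
     hom_orthogonal \<D> U V \<and> R1 \<inter> L2 \<subseteq> U \<star> V"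
proof -
  have "R1 \<inter> L2 \<subseteq> U \<star> V \<longleftrightarrow> (\<forall>X \<in> R1 \<inter> L2. \<exists>Y \<in> U. \<exists>Z \<in> V. tri Y X Z)"
    unfolding star_def by blast
  then show ?thesis
    by (simp add: t_structure_on_heart_def heart_def sub_le_def sub_ge_def)
qed

text \<open>As \<open>L1 \<star> (R1 \<inter> L) = L\<close> and
  \<open>(R \<inter> L2) \<star> R2 = R\<close>, (T1') is just (T1) for
  \<open>(L, R)\<close>.\<close>

lemma restrict_t_structure:
  assumes t1: "t_structure \<D> (L1, R1)" and t2: "t_structure \<D> (L2, R2)"
    and t: "t_structure \<D> (L, R)" and L1: "L1 \<subseteq> L" and L2: "L \<subseteq> L2"
  shows "t_structure_on_heart \<D> (L1, R1) (L2, R2) (R1 \<inter> L2 \<inter> L, R \<inter> (R1 \<inter> L2))"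
proof -
  have R1: "R \<subseteq> R1" and R2: "R2 \<subseteq> R"
    using t_structure_right_antimono[OF t1 t L1] t_structure_right_antimono[OF t t2 L2] .
  have U: "R1 \<inter> L2 \<inter> L = R1 \<inter> L" and V: "R \<inter> (R1 \<inter> L2) = R \<inter> L2" using L2 R1 by blast+
  have rU: "replete_subcat \<D> (R1 \<inter> L)" and rV: "replete_subcat \<D> (R \<inter> L2)"
    using replete_Int t_structureD(1,2) t1 t t2 by blast+
  have "L1 \<star> (R1 \<inter> L) \<subseteq> shift_subcat \<D> (-1) L1 \<star> shift_subcat \<D> (-1) (R1 \<inter> L)"
    unfolding star_shift_minus_1[OF t_structureD(1)[OF t1] rU] t_structure_left_star[OF t1 t L1]
    using shift_subset_iff t_structureD(1,5)[OF t] by blast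
  moreover have "(R \<inter> L2) \<star> R2 \<subseteq> shift_subcat \<D> 1 (R \<inter> L2) \<star> shift_subcat \<D> 1 R2"
  proof -
    have "R \<inter> L2 \<subseteq> Obj \<D>" using t_structureD(4)[OF t] by blast
    from star_shift_1[OF this t_structureD(4)[OF t2]] show ?thesis
      unfolding t_structure_right_star[OF t t2 R2] using t_structureD(6)[OF t] by simp
  qed
  moreover have "hom_orthogonal \<D> (R1 \<inter> L) (R \<inter> L2)"
    using t_structureD(7)[OF t] unfolding hom_orthogonal_def by blast
  moreover have "R1 \<inter> L2 \<subseteq> (R1 \<inter> L) \<star> (R \<inter> L2)"
  proof
    \<comment> \<open>Truncation by \<open>(L, R)\<close> does not leave the heart: \<open>P\<close>
      is a cocone of objects of \<open>R1\<close>, and \<open>Q\<close> is a cone of objects of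
      \<open>L2\<close>.\<close>
    fix X assume X: "X \<in> R1 \<inter> L2"
    then have "X \<in> L \<star> R" using t_structureD(8)[OF t] t_structureD(4)[OF t1] by blast
    then obtain P Q where PQ: "P \<in> L" "Q \<in> R" "tri P X Q" unfolding star_def by blast
    have "P \<in> R1" using t_structure_right_cocone[OF t1 PQ(3)] X PQ R1 by blast
    moreover have "Q \<in> L2" using t_structure_left_cone[OF t2 PQ(3)] X PQ L2 by blast
    ultimately show "X \<in> (R1 \<inter> L) \<star> (R \<inter> L2)" using PQ unfolding star_def by blast
  qed
  ultimately show ?thesis unfolding t_structure_on_heart_iff U V using rU rV L2 R1 by blast
qed

lemma extend_t_structure:
  assumes t1: "t_structure \<D> (L1, R1)" and t2: "t_structure \<D> (L2, R2)" and L12: "L1 \<subseteq> L2"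
    and W: "t_structure_on_heart \<D> (L1, R1) (L2, R2) (U, V)"
  shows "t_structure \<D> (L1 \<star> U, V \<star> R2)"
proof -
  from W have U: "U \<subseteq> R1 \<inter> L2" and V: "V \<subseteq> R1 \<inter> L2"
    and rU: "replete_subcat \<D> U" and rV: "replete_subcat \<D> V"
    and s1: "L1 \<star> U \<subseteq> shift_subcat \<D> (-1) L1 \<star> shift_subcat \<D> (-1) U"
    and s2: "V \<star> R2 \<subseteq> shift_subcat \<D> 1 V \<star> shift_subcat \<D> 1 R2"
    and UV: "hom_orthogonal \<D> U V" and H: "R1 \<inter> L2 \<subseteq> U \<star> V"
    unfolding t_structure_on_heart_iff by blast+
  have rL: "replete_subcat \<D> (L1 \<star> U)" and rR: "replete_subcat \<D> (V \<star> R2)"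
    using star_replete t_structureD(1)[OF t1] rU rV t_structureD(2)[OF t2] by blast+
  have "shift_subcat \<D> 1 (L1 \<star> U) \<subseteq> L1 \<star> U"
    using s1 star_shift_minus_1[OF t_structureD(1)[OF t1] rU] shift_subset_iff[OF rL] by simp
  moreover have "V \<star> R2 \<subseteq> shift_subcat \<D> 1 (V \<star> R2)"
    using s2 star_shift_1[OF _ t_structureD(4)[OF t2]] rV by (simp add: replete_subcat_def)
  moreover have "hom_orthogonal \<D> (L1 \<star> U) (V \<star> R2)"
    \<comment> \<open>The other three orthogonalities come from \<open>V\<close> lying in
      \<open>R1\<close>, \<open>L1\<close> in \<open>L2\<close>, and \<open>U\<close> in
      \<open>L2\<close>.\<close>
    by (rule orthogonal_star[OF _ _ UV])
      (use U V L12 t_structureD(7)[OF t1] t_structureD(7)[OF t2] in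
        \<open>unfold hom_orthogonal_def, blast+\<close>)
  moreover have "X \<in> (L1 \<star> U) \<star> (V \<star> R2)" if "X \<in> Obj \<D>" for X
  proof -
    have "X \<in> (L1 \<star> (R1 \<inter> L2)) \<star> R2"
      using t_structureD(8)[OF t2 that] t_structure_left_star[OF t1 t2 L12] by simp
    also have "\<dots> \<subseteq> (L1 \<star> (U \<star> V)) \<star> R2" by (rule star_mono[OF star_mono[OF subset_refl H] subset_refl])
    also have "\<dots> \<subseteq> ((L1 \<star> U) \<star> V) \<star> R2" by (rule star_mono[OF star_assoc_right subset_refl])
    also have "\<dots> \<subseteq> (L1 \<star> U) \<star> (V \<star> R2)" by (rule star_assoc_left)
    finally show ?thesis .
  qed
  ultimately show ?thesis using rL rR unfolding t_structure_def star_def by auto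
qed

lemma extend_bounds:
  assumes t1: "t_structure \<D> (L1, R1)" and t2: "t_structure \<D> (L2, R2)" and L12: "L1 \<subseteq> L2"
    and W: "t_structure_on_heart \<D> (L1, R1) (L2, R2) (U, V)"
  shows "L1 \<subseteq> L1 \<star> U" "L1 \<star> U \<subseteq> L2" "U \<subseteq> L1 \<star> U" "V \<subseteq> V \<star> R2"
proof -
  note t = extend_t_structure[OF assms]
  from W have U: "U \<subseteq> R1 \<inter> L2" and V: "V \<subseteq> R1 \<inter> L2" and UV: "hom_orthogonal \<D> U V"
    unfolding t_structure_on_heart_iff by blast+
  note v1 = t_structureD(7)[OF t1] and v2 = t_structureD(7)[OF t2]
  have o: "L1 \<subseteq> Obj \<D>" "U \<subseteq> Obj \<D>" "V \<subseteq> Obj \<D>"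
    using t_structureD(3,4)[OF t1] U V by blast+
  have to_R: "vanish X Y" if "Y \<in> V \<star> R2" "X \<in> Obj \<D>" "\<forall>S \<in> V. vanish X S" "\<forall>S \<in> R2. vanish X S"
    for X Y
    using that vanish_to_middle[of _ Y _ X] unfolding star_def by blast
  have from_L: "vanish X Y" if "X \<in> L1 \<star> U" "Y \<in> Obj \<D>" "\<forall>S \<in> L1. vanish S Y" "\<forall>S \<in> U. vanish S Y"
    for X Y
    using that vanish_from_middle[of _ X _ Y] unfolding star_def by blast
  text \<open>Without knowing that \<open>U\<close> contains a zero object, inclusion in a half of the extended
    t-structure is shown by orthogonality to the other half.\<close>
  show "L1 \<subseteq> L1 \<star> U"
  proof
    fix X assume X: "X \<in> L1"
    then have "\<forall>Y \<in> V \<star> R2. vanish X Y" using to_R o V L12 v1 v2 by blast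
    then show "X \<in> L1 \<star> U" using t_structure_left_iff[OF t] X o by blast
  qed
  show "L1 \<star> U \<subseteq> L2"
    using t_structure_left_ext[OF t2] L12 U unfolding star_def by blast
  show "U \<subseteq> L1 \<star> U"
  proof
    fix X assume X: "X \<in> U"
    then have "\<forall>S \<in> V. vanish X S" using UV unfolding hom_orthogonal_def by blast
    then have "\<forall>Y \<in> V \<star> R2. vanish X Y" using to_R o U v2 X by blast
    then show "X \<in> L1 \<star> U" using t_structure_left_iff[OF t] X o by blast
  qed
  show "V \<subseteq> V \<star> R2"
  proof
    fix X assume X: "X \<in> V"
    then have "\<forall>S \<in> U. vanish S X" using UV unfolding hom_orthogonal_def by blast
    then have "\<forall>Y \<in> L1 \<star> U. vanish Y X" using from_L o V v1 X by blast
    then show "X \<in> V \<star> R2" using t_structure_right_iff[OF t] X o by blast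
  qed
qed

text \<open>For \<open>X\<close> in the heart and in \<open>L1 \<star> U\<close>, take a triangle P
  -> X -> Q from (T3'). The cone \<open>Q\<close> is in \<open>L1 \<star> U\<close> and also in
  \<open>V\<close>, so it is orthogonal to itself, hence zero, and \<open>X\<close> is isomorphic to
  \<open>P\<close> in \<open>U\<close>. The other half is dual.\<close>

lemma restrict_extend:
  assumes t1: "t_structure \<D> (L1, R1)" and t2: "t_structure \<D> (L2, R2)" and L12: "L1 \<subseteq> L2"
    and W: "t_structure_on_heart \<D> (L1, R1) (L2, R2) (U, V)"
  shows "R1 \<inter> L2 \<inter> (L1 \<star> U) = U" "V \<star> R2 \<inter> (R1 \<inter> L2) = V"
proof -
  note t = extend_t_structure[OF assms] and b = extend_bounds[OF assms]
  note v = t_structureD(7)[OF t]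
  from W have U: "U \<subseteq> R1 \<inter> L2" and V: "V \<subseteq> R1 \<inter> L2"
    and rU: "replete_subcat \<D> U" and rV: "replete_subcat \<D> V" and H: "R1 \<inter> L2 \<subseteq> U \<star> V"
    unfolding t_structure_on_heart_iff by blast+
  have "X \<in> U" if X: "X \<in> R1 \<inter> L2 \<inter> (L1 \<star> U)" for X
  proof -
    obtain P Q where PQ: "P \<in> U" "Q \<in> V" "tri P X Q" using X H unfolding star_def by blast
    have "Q \<in> L1 \<star> U" using t_structure_left_cone[OF t PQ(3)] PQ(1) b(3) X by blast
    then have "vanish Q Q" using v PQ b(4) by blast
    from tri_zero_right[OF PQ(3) this] show ?thesis using rU PQ unfolding replete_subcat_def by blast
  qed
  then show "R1 \<inter> L2 \<inter> (L1 \<star> U) = U" using U b(3) by blast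
  have "X \<in> V" if X: "X \<in> V \<star> R2 \<inter> (R1 \<inter> L2)" for X
  proof -
    obtain P Q where PQ: "P \<in> U" "Q \<in> V" "tri P X Q" using X H unfolding star_def by blast
    have "P \<in> V \<star> R2" using t_structure_right_cocone[OF t PQ(3)] PQ(2) b(4) X by blast
    then have "vanish P P" using v PQ b(3) by blast
    from iso_obj_sym[OF tri_zero_left[OF PQ(3) this]] show ?thesis
      using rV PQ unfolding replete_subcat_def by blast
  qed
  then show "V \<star> R2 \<inter> (R1 \<inter> L2) = V" using V b(4) by blast
qed

text \<open>The bounds reduce the restricted halves to \<open>R1 \<inter> L\<close> and
  \<open>R \<inter> L2\<close>, for which the decompositions of \<open>L\<close> and
  \<open>R\<close> are known.\<close>

lemma extend_restrict:
  assumes t1: "t_structure \<D> (L1, R1)" and t2: "t_structure \<D> (L2, R2)"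
    and t: "t_structure \<D> (L, R)" and L1: "L1 \<subseteq> L" and L2: "L \<subseteq> L2"
  shows "L1 \<star> (R1 \<inter> L2 \<inter> L) = L" "(R \<inter> (R1 \<inter> L2)) \<star> R2 = R"
proof -
  have R: "R \<subseteq> R1" "R2 \<subseteq> R"
    using t_structure_right_antimono[OF t1 t L1] t_structure_right_antimono[OF t t2 L2] .
  have "R1 \<inter> L2 \<inter> L = R1 \<inter> L" "R \<inter> (R1 \<inter> L2) = R \<inter> L2" using L2 R by blast+
  then show "L1 \<star> (R1 \<inter> L2 \<inter> L) = L" "(R \<inter> (R1 \<inter> L2)) \<star> R2 = R"
    using t_structure_left_star[OF t1 t L1] t_structure_right_star[OF t t2 R(2)] by simp_all
qed

end

theorem theorem1:
  fixes \<D> :: "('o, 'm, 'z) triangulated_data_scheme"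
    and D\<^sub>1 D\<^sub>2 :: "'o set \<times> 'o set"
  assumes "triangulated_category \<D>"
    and "t_structure \<D> D\<^sub>1" and "t_structure \<D> D\<^sub>2"
    and "fst D\<^sub>1 \<subseteq> fst D\<^sub>2"
  shows "restrict_to_heart D\<^sub>1 D\<^sub>2
           \<in> intermediate_t_structures \<D> D\<^sub>1 D\<^sub>2 \<rightarrow> heart_t_structures \<D> D\<^sub>1 D\<^sub>2 \<and>
         extend_from_heart \<D> D\<^sub>1 D\<^sub>2
           \<in> heart_t_structures \<D> D\<^sub>1 D\<^sub>2 \<rightarrow> intermediate_t_structures \<D> D\<^sub>1 D\<^sub>2 \<and>
         (\<forall>T \<in> intermediate_t_structures \<D> D\<^sub>1 D\<^sub>2.
            extend_from_heart \<D> D\<^sub>1 D\<^sub>2 (restrict_to_heart D\<^sub>1 D\<^sub>2 T) = T) \<and>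
         (\<forall>W \<in> heart_t_structures \<D> D\<^sub>1 D\<^sub>2.
            restrict_to_heart D\<^sub>1 D\<^sub>2 (extend_from_heart \<D> D\<^sub>1 D\<^sub>2 W) = W) \<and>
         bij_betw (restrict_to_heart D\<^sub>1 D\<^sub>2)
           (intermediate_t_structures \<D> D\<^sub>1 D\<^sub>2) (heart_t_structures \<D> D\<^sub>1 D\<^sub>2)"
proof -
  interpret triangulated_category \<D> by fact
  obtain L1 R1 L2 R2 where D: "D\<^sub>1 = (L1, R1)" "D\<^sub>2 = (L2, R2)" by (metis surj_pair)
  have t1: "t_structure \<D> (L1, R1)" and t2: "t_structure \<D> (L2, R2)" and L12: "L1 \<subseteq> L2"
    using assms D by auto
  let ?I = "intermediate_t_structures \<D> D\<^sub>1 D\<^sub>2" and ?H = "heart_t_structures \<D> D\<^sub>1 D\<^sub>2"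
  let ?r = "restrict_to_heart D\<^sub>1 D\<^sub>2" and ?e = "extend_from_heart \<D> D\<^sub>1 D\<^sub>2"
  have r: "?r \<in> ?I \<rightarrow> ?H"
    using restrict_t_structure[OF t1 t2]
    by (auto simp: intermediate_t_structures_def heart_t_structures_def restrict_to_heart_def
        heart_def D)
  have e: "?e \<in> ?H \<rightarrow> ?I"
  proof
    fix W assume "W \<in> ?H"
    moreover obtain U V where "W = (U, V)" by (metis surj_pair)
    ultimately show "?e W \<in> ?I"
      using extend_t_structure[OF t1 t2 L12, of U V] extend_bounds(1,2)[OF t1 t2 L12, of U V]
      by (simp add: intermediate_t_structures_def heart_t_structures_def extend_from_heart_def D)
  qed
  have er: "\<forall>T \<in> ?I. ?e (?r T) = T"
    using extend_restrict[OF t1 t2]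
    by (auto simp: intermediate_t_structures_def extend_from_heart_def restrict_to_heart_def
        heart_def D)
  have re: "\<forall>W \<in> ?H. ?r (?e W) = W"
  proof
    fix W assume "W \<in> ?H"
    moreover obtain U V where "W = (U, V)" by (metis surj_pair)
    ultimately show "?r (?e W) = W"
      using restrict_extend[OF t1 t2 L12, of U V]
      by (simp add: heart_t_structures_def extend_from_heart_def restrict_to_heart_def heart_def D)
  qed
  have "bij_betw ?r ?I ?H"
    by (rule bij_betw_byWitness[of _ ?e]) (use r e er re in auto)
  then show ?thesis using r e er re by blast
qed

end
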